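(* Let $X$ be a compact open subset of $\mathbb{Q}_p$ and let $f:X\to X$ be a locally $1$-Lipschitz rational function. Let $l\in\mathbb{Z}$ be such that $B_{p^l}(a)\subset X$ for all $a\in X$ and $|f(x)-f(y)|\le |x-y|$ whenever $a\in X$ and $x,y\in B_{p^l}(a)$. The following statements are equivalent. (1) $f$ is measure-preserving. (2) $f$ is invertible. (3) $f$ is invertible and locally isometric. (4) For all integers $t\le l$, the digraph $G(f,p^t)$ is a disjoint union of cycles.
   Context: $|\cdot|$ is the usual $p$-adic absolute value, $B_r(a)=\{x\in\mathbb{Q}_p : |x-a|\le r\}$, and $\mu$ is Haar measure on $\mathbb{Q}_p$ with $\mu(B_{p^k}(a))=p^k$ for all $k\in\mathbb{Z}$. A rational function $f:X\to X$ means $f=P/Q$ with $P,Q\in\mathbb{Z}_p[x]$ coprime, $Q$ having no root in $X$, and $f(X)\subset X$. It is locally $1$-Lipschitz if for every $a\in X$ there is $r>0$ with $|f(x)-f(y)|\le|x-y|$ for all $x,y\in B_r(a)$; on compact open $X$ one can take a single $r=p^l$ valid for all $a$ (and with the balls contained in $X$). It is locally isometric if for every $a\in X$ there is $r>0$ with $|f(x)-f(y)|=|x-y|$ for all $x,y\in B_r(a)$. Invertible means that $f:X\to X$ is a bijection. Measure-preserving means $\mu(f^{-1}(A))=\mu(A)$ for all Borel $A\subset X$. Digraph $G(f,p^t)$ for an integer $t\le l$: write $X=\bigsqcup_{i=1}^m D_{t,i}$ uniquely as a disjoint union of closed balls of radius $p^t$. The vertices are $A_{t,1},\dots,A_{t,m}$,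 and there is a directed edge from $A_{t,i}$ to $A_{t,j}$ if and only if $f(D_{t,i})\subset D_{t,j}$ (every vertex has outdegree $1$). Cycles are directed cycles; a loop at a vertex counts as a cycle of length $1$. *)

theory Defs
  imports
    "HOL-Analysis.Analysis"
    "Berlekamp_Zassenhaus.Finite_Field"
    "Graph_Theory.Graph_Theory"
begin

section \<open>The \<open>p\<close>-adic absolute value on the rationals\<close>

definition rat_padic_abs :: "nat \<Rightarrow> rat \<Rightarrow> real"
  where "rat_padic_abs p q =
    (if q = 0 then 0
     else real p powi (int (multiplicity (int p) (snd (quotient_of q)))
                     - int (multiplicity (int p) (fst (quotient_of q)))))"

locale padic_prime =
  fixes p :: nat
  assumes prime: "prime p"
begin

abbreviation nm :: "rat \<Rightarrow> real" where "nm \<equiv> rat_padic_abs p"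

lemma p_gt_1: "real p > 1"
  using prime prime_gt_1_nat by auto

lemma prime_elem_p: "prime_elem (int p)"
  using prime by simp

lemma nm_0 [simp]: "nm 0 = 0"
  by (simp add: rat_padic_abs_def)

lemma nm_nonneg [simp]: "nm q \<ge> 0"
  by (simp add: rat_padic_abs_def)

lemma nm_pos: "q \<noteq> 0 \<Longrightarrow> nm q > 0"
  using p_gt_1 by (simp add: rat_padic_abs_def)

lemma nm_eq_0 [simp]: "nm q = 0 \<longleftrightarrow> q = 0"
  using nm_pos[of q] by fastforce

lemma nm_frac:
  assumes "a \<noteq> 0" "b \<noteq> 0"
  shows "nm (of_int a / of_int b)
    = real p powi (int (multiplicity (int p) b) - int (multiplicity (int p) a))"
proof -
  define q :: rat where "q = of_int a / of_int b"
  obtain c d where cd: "quotient_of q = (c, d)"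
    by (cases "quotient_of q")
  have q: "q = of_int c / of_int d" "d > 0"
    using quotient_of_div[OF cd] quotient_of_denom_pos[OF cd] by auto
  have "q \<noteq> 0"
    using assms by (simp add: q_def)
  with q have "c \<noteq> 0" by auto
  have "(of_int a :: rat) * of_int d = of_int c * of_int b"
    using q q_def assms by (simp add: field_simps)
  then have "a * d = c * b"
    by (metis of_int_eq_iff of_int_mult)
  then have "multiplicity (int p) (a * d) = multiplicity (int p) (c * b)"
    by simp
  then have "multiplicity (int p) a + multiplicity (int p) d
      = multiplicity (int p) c + multiplicity (int p) b"
    using assms \<open>c \<noteq> 0\<close> q(2)
    by (simp add: prime_elem_multiplicity_mult_distrib[OF prime_elem_p])
  then have "int (multiplicity (int p) d) - int (multiplicity (int p) c)
      = int (multiplicity (int p) b) - int (multiplicity (int p) a)"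
    by linarith
  then show ?thesis
    using \<open>q \<noteq> 0\<close> cd unfolding rat_padic_abs_def q_def[symmetric] by simp
qed

lemma rat_cases_frac:
  obtains a b where "b \<noteq> 0" "(q::rat) = of_int a / of_int b"
proof -
  obtain c d where cd: "quotient_of q = (c, d)"
    by (cases "quotient_of q")
  show ?thesis
    using that[of d c] quotient_of_div[OF cd] quotient_of_denom_pos[OF cd] by auto
qed

lemma nm_mult: "nm (q * r) = nm q * nm r"
proof (cases "q = 0 \<or> r = 0")
  case False
  obtain a b where q: "b \<noteq> 0" "q = of_int a / of_int b" by (rule rat_cases_frac)
  obtain c d where r: "d \<noteq> 0" "r = of_int c / of_int d" by (rule rat_cases_frac)
  have nz: "a \<noteq> 0" "c \<noteq> 0" using False q r by auto
  have qr: "q * r = of_int (a * c) / of_int (b * d)" using q r by simp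
  have "nm (q * r) = real p powi (int (multiplicity (int p) (b * d))
      - int (multiplicity (int p) (a * c)))"
    unfolding qr by (rule nm_frac) (use q r nz in auto)
  also have "\<dots> = real p powi ((int (multiplicity (int p) b) - int (multiplicity (int p) a))
      + (int (multiplicity (int p) d) - int (multiplicity (int p) c)))"
    using q r nz
    by (simp add: prime_elem_multiplicity_mult_distrib[OF prime_elem_p] algebra_simps)
  also have "\<dots> = nm q * nm r"
    using p_gt_1 q r nz by (simp add: power_int_add nm_frac)
  finally show ?thesis .
qed auto

lemma nm_1 [simp]: "nm 1 = 1"
  using nm_frac[of 1 1] by simp

lemma nm_minus [simp]: "nm (- q) = nm q"
proof -
  have "(nm (-1))\<^sup>2 = 1"
    using nm_mult[of "-1" "-1"] by (simp add: power2_eq_square)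
  then have "nm (-1) = 1"
    using nm_nonneg[of "-1"] by (simp add: power2_eq_1_iff)
  then show ?thesis
    using nm_mult[of "-1" q] by simp
qed

lemma nm_minus_commute: "nm (q - r) = nm (r - q)"
  using nm_minus[of "q - r"] by simp

lemma nm_inverse: "nm (inverse q) = inverse (nm q)"
proof (cases "q = 0")
  case False
  then have "nm (inverse q) * nm q = 1"
    using nm_mult[of "inverse q" q] by simp
  then show ?thesis
    using inverse_unique by (metis mult.commute)
qed simp

lemma nm_add: "nm (q + r) \<le> max (nm q) (nm r)"
proof (cases "q = 0 \<or> r = 0 \<or> q + r = 0")
  case True
  then show ?thesis by (auto simp: max_def)
next
  case False
  obtain a b where q: "b \<noteq> 0" "q = of_int a / of_int b" by (rule rat_cases_frac)
  obtain c d where r: "d \<noteq> 0" "r = of_int c / of_int d" by (rule rat_cases_frac)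
  define x y z where "x = a * d" and "y = c * b" and "z = b * d"
  have z: "z \<noteq> 0" using q r by (simp add: z_def)
  have qx: "q = of_int x / of_int z" and ry: "r = of_int y / of_int z"
    using q r by (simp_all add: x_def y_def z_def)
  have qr: "q + r = of_int (x + y) / of_int z"
    unfolding qx ry by (simp add: add_divide_distrib)
  have nz: "x \<noteq> 0" "y \<noteq> 0" "x + y \<noteq> 0"
    using False qx ry qr by auto
  define m where "m = min (multiplicity (int p) x) (multiplicity (int p) y)"
  have "int p ^ m dvd x" "int p ^ m dvd y"
    by (auto simp: m_def intro!: multiplicity_dvd')
  then have "int p ^ m dvd x + y" by simp
  then have m: "m \<le> multiplicity (int p) (x + y)"
    using nz prime_elem_p by (intro multiplicity_geI) auto
  have "nm (q + r) = real p powi (int (multiplicity (int p) z) - int (multiplicity (int p) (x + y)))"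
    unfolding qr using nz z by (intro nm_frac)
  also have "\<dots> \<le> real p powi (int (multiplicity (int p) z) - int m)"
    using p_gt_1 m by (intro power_int_increasing) auto
  also have "\<dots> \<le> max (nm q) (nm r)"
    unfolding qx ry using nz z by (auto simp: nm_frac m_def min_def max_def)
  finally show ?thesis .
qed

lemma nm_triangle: "nm (q + r) \<le> nm q + nm r"
  using nm_add[of q r] nm_nonneg[of q] nm_nonneg[of r] by linarith

lemma nm_diff_ge: "\<bar>nm q - nm r\<bar> \<le> nm (q - r)"
  using nm_triangle[of "q - r" r] nm_triangle[of "r - q" q] nm_minus_commute[of q r] by simp


section \<open>Cauchy sequences of rationals\<close>

definition cau :: "(nat \<Rightarrow> rat) \<Rightarrow> bool"
  where "cau X \<longleftrightarrow> (\<forall>e>0. \<exists>N. \<forall>m\<ge>N. \<forall>n\<ge>N. nm (X m - X n) < e)"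

definition van :: "(nat \<Rightarrow> rat) \<Rightarrow> bool"
  where "van X \<longleftrightarrow> (\<lambda>n. nm (X n)) \<longlonglongrightarrow> 0"

definition prel :: "(nat \<Rightarrow> rat) \<Rightarrow> (nat \<Rightarrow> rat) \<Rightarrow> bool"
  where "prel X Y \<longleftrightarrow> cau X \<and> cau Y \<and> van (\<lambda>n. X n - Y n)"

lemma van_le:
  assumes "van X" "van Y" "eventually (\<lambda>n. nm (Z n) \<le> C * nm (X n) + D * nm (Y n)) sequentially"
  shows "van Z"
proof -
  have "(\<lambda>n. C * nm (X n) + D * nm (Y n)) \<longlonglongrightarrow> C * 0 + D * 0"
    using assms(1,2) unfolding van_def by (intro tendsto_intros)
  then show ?thesis
    unfolding van_def using assms(3)
    by (intro real_tendsto_sandwich[OF _ assms(3) tendsto_const]) auto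
qed

lemma van_const [simp]: "van (\<lambda>n. c) \<longleftrightarrow> c = 0"
  by (simp add: van_def LIMSEQ_const_iff)

lemma van_minus: "van X \<Longrightarrow> van (\<lambda>n. - X n)"
  by (simp add: van_def)

lemma van_swap: "van (\<lambda>n. X n - Y n) \<Longrightarrow> van (\<lambda>n. Y n - X n)"
  using van_minus by fastforce

lemma van_add: "van X \<Longrightarrow> van Y \<Longrightarrow> van (\<lambda>n. X n + Y n)"
  by (rule van_le[of X Y _ 1 1]) (auto simp: nm_triangle)

lemma cau_const [simp]: "cau (\<lambda>n. c)"
  by (simp add: cau_def)

lemma cau_Cauchy_nm:
  assumes "cau X"
  shows "Cauchy (\<lambda>n. nm (X n))"
  unfolding Cauchy_def dist_real_def
  using assms nm_diff_ge order.strict_trans1 unfolding cau_def by meson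

lemma cau_bounded:
  assumes "cau X"
  obtains B where "B > 0" "\<And>n. nm (X n) \<le> B"
proof -
  have "Bseq (\<lambda>n. nm (X n))"
    using cau_Cauchy_nm[OF assms] Cauchy_Bseq by blast
  then show ?thesis
    using that by (auto elim!: BseqE)
qed

lemma cau_le:
  assumes "cau X" "cau Y" "C > 0" "D > 0"
    "\<And>m n. m \<ge> M \<Longrightarrow> n \<ge> M \<Longrightarrow> nm (Z m - Z n) \<le> C * nm (X m - X n) + D * nm (Y m - Y n)"
  shows "cau Z"
  unfolding cau_def
proof (intro allI impI)
  fix e :: real assume e: "e > 0"
  obtain N1 where N1: "\<And>m n. m \<ge> N1 \<Longrightarrow> n \<ge> N1 \<Longrightarrow> nm (X m - X n) < e / (2 * C)"
    using assms(1,3) e unfolding cau_def by (meson divide_pos_pos mult_pos_pos zero_less_numeral)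
  obtain N2 where N2: "\<And>m n. m \<ge> N2 \<Longrightarrow> n \<ge> N2 \<Longrightarrow> nm (Y m - Y n) < e / (2 * D)"
    using assms(2,4) e unfolding cau_def by (meson divide_pos_pos mult_pos_pos zero_less_numeral)
  have "nm (Z m - Z n) < e" if "m \<ge> max M (max N1 N2)" "n \<ge> max M (max N1 N2)" for m n
  proof -
    have "C * nm (X m - X n) < e / 2" "D * nm (Y m - Y n) < e / 2"
      using N1[of m n] N2[of m n] that assms(3,4) by (auto simp: field_simps)
    then show ?thesis
      using assms(5)[of m n] that by simp
  qed
  then show "\<exists>N. \<forall>m\<ge>N. \<forall>n\<ge>N. nm (Z m - Z n) < e" by blast
qed

lemma cau_add:
  assumes "cau X" "cau Y"
  shows "cau (\<lambda>n. X n + Y n)"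
  by (rule cau_le[OF assms, of 1 1 0]) (auto simp: add_diff_add nm_triangle)

lemma cau_minus: "cau X \<Longrightarrow> cau (\<lambda>n. - X n)"
  unfolding cau_def minus_diff_minus nm_minus .

lemma cau_mult:
  assumes "cau X" "cau Y"
  shows "cau (\<lambda>n. X n * Y n)"
proof -
  obtain A where A: "A > 0" "\<And>n. nm (X n) \<le> A" by (rule cau_bounded[OF assms(1)]) blast
  obtain B where B: "B > 0" "\<And>n. nm (Y n) \<le> B" by (rule cau_bounded[OF assms(2)]) blast
  show ?thesis
  proof (rule cau_le[OF assms, of B A 0])
    fix m n
    have "nm (X m * Y m - X n * Y n) \<le> nm (X m * (Y m - Y n)) + nm ((X m - X n) * Y n)"
      unfolding mult_diff_mult by (rule nm_triangle)
    also have "\<dots> \<le> A * nm (Y m - Y n) + nm (X m - X n) * B"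
      unfolding nm_mult using A B by (intro add_mono mult_right_mono mult_left_mono) auto
    finally show "nm (X m * Y m - X n * Y n) \<le> B * nm (X m - X n) + A * nm (Y m - Y n)"
      by (simp add: mult.commute add.commute)
  qed (use A B in auto)
qed

lemma van_mult:
  assumes "cau X" "van Y"
  shows "van (\<lambda>n. X n * Y n)"
proof -
  obtain A where A: "A > 0" "\<And>n. nm (X n) \<le> A" by (rule cau_bounded[OF assms(1)]) blast
  show ?thesis
    by (rule van_le[OF assms(2) assms(2), of _ A 0])
      (use A in \<open>auto simp: nm_mult intro!: mult_right_mono always_eventually\<close>)
qed

lemma cau_not_van:
  assumes "cau X" "\<not> van X"
  obtains b N where "b > 0" "\<And>n. n \<ge> N \<Longrightarrow> nm (X n) \<ge> b" "\<And>n. n \<ge> N \<Longrightarrow> X n \<noteq> 0"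
proof -
  obtain L where L: "(\<lambda>n. nm (X n)) \<longlonglongrightarrow> L"
    using cau_Cauchy_nm[OF assms(1)] Cauchy_convergent_iff convergent_def by blast
  have "L \<ge> 0" using L by (rule LIMSEQ_le_const) auto
  moreover have "L \<noteq> 0" using L assms(2) by (auto simp: van_def)
  ultimately have "L / 2 < L" "L > 0" by auto
  then obtain N where "\<And>n. n \<ge> N \<Longrightarrow> nm (X n) > L / 2"
    using order_tendstoD(1)[OF L] unfolding eventually_sequentially by blast
  then show ?thesis
    using that[of "L / 2" N] \<open>L > 0\<close> by fastforce
qed

lemma cau_inverse:
  assumes "cau X" "\<not> van X"
  shows "cau (\<lambda>n. inverse (X n))"
proof -
  obtain b N where b: "b > 0" "\<And>n. n \<ge> N \<Longrightarrow> nm (X n) \<ge> b" "\<And>n. n \<ge> N \<Longrightarrow> X n \<noteq> 0"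
    by (rule cau_not_van[OF assms]) blast
  show ?thesis
  proof (rule cau_le[OF assms(1) cau_const[of 0], of "inverse b * inverse b" 1 N])
    fix m n assume mn: "m \<ge> N" "n \<ge> N"
    have "nm (inverse (X m) - inverse (X n)) = inverse (nm (X m)) * nm (X m - X n) * inverse (nm (X n))"
      using b mn by (simp add: inverse_diff_inverse nm_mult nm_inverse)
    also have "\<dots> \<le> inverse b * nm (X m - X n) * inverse b"
      using b mn by (intro mult_mono le_imp_inverse_le) auto
    finally show "nm (inverse (X m) - inverse (X n))
        \<le> inverse b * inverse b * nm (X m - X n) + 1 * nm (0 - 0)"
      by (simp add: mult_ac)
  qed (use b in auto)
qed

lemma van_inverse_mult:
  assumes "cau X" "\<not> van X"
  shows "van (\<lambda>n. inverse (X n) * X n - 1)"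
proof -
  obtain b N where b: "\<And>n. n \<ge> N \<Longrightarrow> X n \<noteq> 0"
    using cau_not_van[OF assms] by metis
  have "eventually (\<lambda>n. nm (inverse (X n) * X n - 1) = 0) sequentially"
    unfolding eventually_sequentially by (intro exI[of _ N]) (auto simp: b)
  then show ?thesis
    unfolding van_def by (rule tendsto_eventually)
qed

lemma van_diff_inverse:
  assumes "cau X" "\<not> van X" "cau Y" "\<not> van Y" "van (\<lambda>n. X n - Y n)"
  shows "van (\<lambda>n. inverse (X n) - inverse (Y n))"
proof -
  obtain N where N: "\<And>n. n \<ge> N \<Longrightarrow> X n \<noteq> 0"
    using cau_not_van[OF assms(1,2)] by metis
  obtain M where M: "\<And>n. n \<ge> M \<Longrightarrow> Y n \<noteq> 0"
    using cau_not_van[OF assms(3,4)] by metis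
  have *: "van (\<lambda>n. (inverse (X n) * inverse (Y n)) * (Y n - X n))"
    by (intro van_mult cau_mult cau_inverse van_swap[OF assms(5)] assms)
  have **: "eventually (\<lambda>n. nm (inverse (X n) - inverse (Y n))
      \<le> 1 * nm ((inverse (X n) * inverse (Y n)) * (Y n - X n)) + 0 * nm ((inverse (X n) * inverse (Y n)) * (Y n - X n))) sequentially"
    unfolding eventually_sequentially
  proof (intro exI[of _ "max M N"] allI impI)
    fix n assume "n \<ge> max M N"
    then have "X n \<noteq> 0" "Y n \<noteq> 0" using N M by auto
    then have "inverse (X n) - inverse (Y n) = (inverse (X n) * inverse (Y n)) * (Y n - X n)"
      by (simp add: field_simps)
    then show "nm (inverse (X n) - inverse (Y n))
      \<le> 1 * nm ((inverse (X n) * inverse (Y n)) * (Y n - X n)) + 0 * nm ((inverse (X n) * inverse (Y n)) * (Y n - X n))"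
      by simp
  qed
  show ?thesis by (rule van_le[OF * * **])
qed

lemma van_cong:
  assumes "van (\<lambda>n. X n - Y n)"
  shows "van X \<longleftrightarrow> van Y"
proof
  assume "van X"
  from van_add[OF this van_swap[OF assms]] show "van Y" by simp
next
  assume "van Y"
  from van_add[OF this assms] show "van X" by simp
qed

lemma prel_refl: "cau X \<Longrightarrow> prel X X"
  by (simp add: prel_def)

lemma part_equivp_prel: "part_equivp prel"
proof (rule part_equivpI)
  show "\<exists>x. prel x x" using prel_refl[OF cau_const[of 0]] by blast
  show "symp prel" by (auto simp: symp_def prel_def van_swap)
  show "transp prel"
    unfolding transp_def prel_def using van_add by fastforce
qed

lemma prel_mult:
  assumes "prel X X'" "prel Y Y'"
  shows "prel (\<lambda>n. X n * Y n) (\<lambda>n. X' n * Y' n)"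
proof -
  have "van (\<lambda>n. X n * (Y n - Y' n) + Y' n * (X n - X' n))"
    using assms unfolding prel_def by (intro van_add van_mult) auto
  then show ?thesis
    using assms by (auto simp: prel_def cau_mult algebra_simps)
qed

lemma prel_lim:
  assumes "prel X Y"
  shows "lim (\<lambda>n. nm (X n)) = lim (\<lambda>n. nm (Y n))"
proof -
  obtain L where L: "(\<lambda>n. nm (X n)) \<longlonglongrightarrow> L"
    using cau_Cauchy_nm[of X] assms Cauchy_convergent_iff convergent_def prel_def by blast
  have "(\<lambda>n. nm (X n) - nm (Y n)) \<longlonglongrightarrow> 0"
  proof (rule Lim_null_comparison)
    show "(\<lambda>n. nm (X n - Y n)) \<longlonglongrightarrow> 0"
      using assms by (simp add: prel_def van_def)
  qed (auto simp: nm_diff_ge)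
  from tendsto_diff[OF L this] have "(\<lambda>n. nm (Y n)) \<longlonglongrightarrow> L" by simp
  with L show ?thesis by (simp add: limI)
qed

lemma cau_lim: "cau X \<Longrightarrow> (\<lambda>n. nm (X n)) \<longlonglongrightarrow> lim (\<lambda>n. nm (X n))"
  using cau_Cauchy_nm Cauchy_convergent_iff convergent_LIMSEQ_iff by blast

end


section \<open>The field of \<open>p\<close>-adic numbers\<close>

text \<open>The prime is carried by a type: \<open>p = CARD('p)\<close> where \<open>'p :: prime_card\<close>.
  A free type variable \<open>'p\<close> in a theorem thus stands for an arbitrary prime.\<close>

lemma padic_prime_CARD: "padic_prime CARD('p::prime_card)"
  by standard (rule prime_card)

interpretation padic: padic_prime "CARD('p::prime_card)"
  by (rule padic_prime_CARD)

definition padic_rel :: "'p::prime_card itself \<Rightarrow> (nat \<Rightarrow> rat) \<Rightarrow> (nat \<Rightarrow> rat) \<Rightarrow> bool"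
  where "padic_rel _ = padic_prime.prel CARD('p)"

lemma part_equivp_padic_rel: "part_equivp (padic_rel TYPE('p::prime_card))"
  unfolding padic_rel_def by (rule padic.part_equivp_prel)

(* quotient_type does not support the sort constraint prime_card, hence the quotient by hand. *)
typedef (overloaded) ('p::prime_card) padic =
    "{C. \<exists>X. padic_rel TYPE('p) X X \<and> C = Collect (padic_rel TYPE('p) X)}"
  morphisms padic_class abs_padic_class
  using part_equivp_padic_rel[where 'p = 'p] unfolding part_equivp_def by blast

definition Padic :: "(nat \<Rightarrow> rat) \<Rightarrow> 'p::prime_card padic"
  where "Padic X = abs_padic_class (Collect (padic_rel TYPE('p) X))"

definition rep_padic :: "'p::prime_card padic \<Rightarrow> nat \<Rightarrow> rat"
  where "rep_padic x = (SOME X. X \<in> padic_class x)"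

lemma Quotient3_padic: "Quotient3 (padic_rel TYPE('p)) Padic (rep_padic :: 'p::prime_card padic \<Rightarrow> _)"
proof -
  interpret quot_type "padic_rel TYPE('p)" "abs_padic_class :: _ \<Rightarrow> 'p padic" padic_class
  proof
    show "part_equivp (padic_rel TYPE('p))" by (rule part_equivp_padic_rel)
  qed (use padic_class[where 'p = 'p] abs_padic_class_inverse[where 'p = 'p] in
      \<open>auto simp: padic_class_inverse padic_class_inject\<close>)
  show ?thesis
    using Quotient unfolding abs_def rep_def Padic_def[abs_def] rep_padic_def[abs_def] .
qed

definition cr_padic :: "(nat \<Rightarrow> rat) \<Rightarrow> 'a::prime_card padic \<Rightarrow> bool"
  where "cr_padic = (\<lambda>X x. padic_rel TYPE('a) X X \<and> Padic X = x)"

lemma Quotient_padic: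
  "Quotient (padic_rel TYPE('a)) Padic (rep_padic :: 'a::prime_card padic \<Rightarrow> _) cr_padic"
  by (rule Quotient3_to_Quotient[OF Quotient3_padic]) (simp add: cr_padic_def)

setup_lifting Quotient_padic

lemma padic_rel_iff:
  "padic_rel TYPE('p::prime_card) X Y \<longleftrightarrow>
    padic_prime.cau CARD('p) X \<and> padic_prime.cau CARD('p) Y \<and> padic_prime.van CARD('p) (\<lambda>n. X n - Y n)"
  by (simp add: padic_rel_def padic.prel_def)

lemma Domainp_pcr_padic [transfer_domain_rule]:
  "Domainp (pcr_padic :: _ \<Rightarrow> 'p padic \<Rightarrow> bool) = padic_prime.cau CARD('p::prime_card)"
  by (simp add: padic.domain_eq padic_rel_iff fun_eq_iff)

instantiation padic :: (prime_card) field
begin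

lift_definition zero_padic :: "'a padic" is "\<lambda>n. 0"
  by (simp add: padic_rel_iff)

lift_definition one_padic :: "'a padic" is "\<lambda>n. 1"
  by (simp add: padic_rel_iff)

lift_definition plus_padic :: "'a padic \<Rightarrow> 'a padic \<Rightarrow> 'a padic" is "\<lambda>X Y n. X n + Y n"
  unfolding padic_rel_iff add_diff_add by (simp add: padic.cau_add padic.van_add)

lift_definition uminus_padic :: "'a padic \<Rightarrow> 'a padic" is "\<lambda>X n. - X n"
  unfolding padic_rel_iff minus_diff_minus by (simp add: padic.cau_minus padic.van_minus padic.van_swap)

lift_definition times_padic :: "'a padic \<Rightarrow> 'a padic \<Rightarrow> 'a padic" is "\<lambda>X Y n. X n * Y n"
  unfolding padic_rel_def by (rule padic.prel_mult)

lift_definition inverse_padic :: "'a padic \<Rightarrow> 'a padic"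
  is "\<lambda>X. if padic_prime.van CARD('a) X then (\<lambda>n. 0) else (\<lambda>n. inverse (X n))"
  unfolding padic_rel_iff
  using padic.van_cong by (auto simp: padic.cau_inverse padic.van_diff_inverse)

definition "x - y = x + - y" for x y :: "'a padic"

definition "x div y = x * inverse y" for x y :: "'a padic"

instance
proof
  fix a b c :: "'a padic"
  show "a + b = b + a"
    by transfer (simp add: ac_simps padic_rel_iff padic.cau_add)
  show "(a + b) + c = a + (b + c)"
    by transfer (simp add: ac_simps padic_rel_iff padic.cau_add)
  show "0 + a = a"
    by transfer (simp add: padic_rel_iff)
  show "- a + a = 0"
    by transfer (simp add: padic_rel_iff)
  show "a - b = a + - b"
    by (rule minus_padic_def)
  show "(a * b) * c = a * (b * c)"
    by transfer (simp add: ac_simps padic_rel_iff padic.cau_mult)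
  show "a * b = b * a"
    by transfer (simp add: ac_simps padic_rel_iff padic.cau_mult)
  show "1 * a = a"
    by transfer (simp add: padic_rel_iff)
  show "(a + b) * c = a * c + b * c"
    by transfer (simp add: distrib_right padic_rel_iff padic.cau_add padic.cau_mult)
  show "(0::'a padic) \<noteq> 1"
    by transfer (simp add: padic_rel_iff)
  show "a \<noteq> 0 \<Longrightarrow> inverse a * a = 1"
    by transfer (auto simp: padic_rel_iff padic.cau_mult padic.cau_inverse padic.van_inverse_mult)
  show "a div b = a * inverse b"
    by (rule divide_padic_def)
  show "inverse (0::'a padic) = 0"
    by transfer (simp add: padic_rel_iff)
qed

end


lemma of_nat_padic: "padic_rel TYPE('p) (\<lambda>_. of_nat n) (\<lambda>_. of_nat n)
    \<and> (of_nat n :: 'p::prime_card padic) = Padic (\<lambda>_. of_nat n)"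
proof (induction n)
  case 0
  then show ?case
    using zero_padic.abs_eq by (simp add: padic_rel_iff)
next
  case (Suc n)
  have "(1 :: 'p padic) = Padic (\<lambda>_. 1)" "padic_rel TYPE('p) (\<lambda>_. 1) (\<lambda>_. 1)"
    by (simp_all add: one_padic.abs_eq padic_rel_iff)
  with Suc show ?case
    using plus_padic.abs_eq[of "\<lambda>_. 1" "\<lambda>_. of_nat n", where 'a = 'p]
    by (simp add: padic_rel_iff)
qed

lemma Padic_eq_iff:
  "padic_prime.cau CARD('p) X \<Longrightarrow> padic_prime.cau CARD('p) Y \<Longrightarrow>
    (Padic X :: 'p::prime_card padic) = Padic Y \<longleftrightarrow> padic_prime.van CARD('p) (\<lambda>n. X n - Y n)"
  using Quotient_rel[OF Quotient_padic[where 'a = 'p], of X Y] by (simp add: padic_rel_iff)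

instance padic :: (prime_card) field_char_0
proof
  show "inj (of_nat :: nat \<Rightarrow> 'a padic)"
    by (rule injI) (simp add: of_nat_padic Padic_eq_iff)
qed


section \<open>Absolute value and topology\<close>

(* Not the overloaded norm of the library: that one is constrained to real normed vector spaces. *)
lift_definition padic_abs :: "'a::prime_card padic \<Rightarrow> real"
  is "\<lambda>X. lim (\<lambda>n. rat_padic_abs CARD('a) (X n))"
  unfolding padic_rel_def by (rule padic.prel_lim)

lemma padic_abs_eq_0 [simp]: "padic_abs (x :: 'a::prime_card padic) = 0 \<longleftrightarrow> x = 0"
proof transfer
  fix X assume X: "padic_prime.cau CARD('a) X"
  have "lim (\<lambda>n. rat_padic_abs CARD('a) (X n)) = 0 \<longleftrightarrow> padic_prime.van CARD('a) X"
    unfolding padic.van_def using padic.cau_lim[OF X] limI by metis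
  then show "lim (\<lambda>n. rat_padic_abs CARD('a) (X n)) = 0 \<longleftrightarrow> padic_rel TYPE('a) X (\<lambda>n. 0)"
    using X by (simp add: padic_rel_iff)
qed

lemma padic_abs_0 [simp]: "padic_abs 0 = 0"
  by simp

lemma padic_abs_nonneg [simp]: "padic_abs (x :: 'a::prime_card padic) \<ge> 0"
  by transfer (rule LIMSEQ_le_const[OF padic.cau_lim], auto)

lemma padic_abs_minus [simp]: "padic_abs (- x :: 'a::prime_card padic) = padic_abs x"
  by transfer simp

lemma padic_abs_add_le_max: "padic_abs (x + y :: 'a::prime_card padic) \<le> max (padic_abs x) (padic_abs y)"
proof transfer
  fix X Y assume *: "padic_prime.cau CARD('a) X" "padic_prime.cau CARD('a) Y"
  show "lim (\<lambda>n. rat_padic_abs CARD('a) (X n + Y n))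
    \<le> max (lim (\<lambda>n. rat_padic_abs CARD('a) (X n))) (lim (\<lambda>n. rat_padic_abs CARD('a) (Y n)))"
    by (rule LIMSEQ_le[OF padic.cau_lim[OF padic.cau_add[OF *]]
          tendsto_max[OF padic.cau_lim[OF *(1)] padic.cau_lim[OF *(2)]]])
      (auto simp: padic.nm_add)
qed

instantiation padic :: (prime_card) metric_space
begin

definition dist_padic :: "'a padic \<Rightarrow> 'a padic \<Rightarrow> real"
  where "dist_padic x y = padic_abs (x - y)"

definition uniformity_padic :: "('a padic \<times> 'a padic) filter"
  where "uniformity_padic = (INF e\<in>{0<..}. principal {(x, y). dist x y < e})"

definition open_padic :: "'a padic set \<Rightarrow> bool"
  where "open_padic U \<longleftrightarrow> (\<forall>x\<in>U. \<forall>\<^sub>F (x', y) in uniformity. x' = x \<longrightarrow> y \<in> U)"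

instance
proof
  fix x y z :: "'a padic"
  show "dist x y = 0 \<longleftrightarrow> x = y"
    by (simp add: dist_padic_def)
  have "dist x y = padic_abs ((x - z) + (z - y))"
    by (simp add: dist_padic_def)
  also have "\<dots> \<le> max (padic_abs (x - z)) (padic_abs (z - y))"
    by (rule padic_abs_add_le_max)
  also have "\<dots> \<le> padic_abs (x - z) + padic_abs (z - y)"
    by simp
  also have "padic_abs (z - y) = padic_abs (y - z)"
    using padic_abs_minus[of "y - z"] by simp
  finally show "dist x y \<le> dist x z + dist y z"
    by (simp add: dist_padic_def)
  show "(uniformity :: ('a padic \<times> 'a padic) filter)
      = (INF e\<in>{0<..}. principal {(x, y). dist x y < e})"
    by (rule uniformity_padic_def)
  show "open U \<longleftrightarrow> (\<forall>x\<in>U. \<forall>\<^sub>F (x', y) in uniformity. x' = x \<longrightarrow> y \<in> U)"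
    for U :: "'a padic set"
    by (rule open_padic_def)
qed

end

lemma padic_abs_mult: "padic_abs (x * y :: 'p::prime_card padic) = padic_abs x * padic_abs y"
proof transfer
  fix X Y assume *: "padic_prime.cau CARD('p) X" "padic_prime.cau CARD('p) Y"
  show "lim (\<lambda>n. rat_padic_abs CARD('p) (X n * Y n))
    = lim (\<lambda>n. rat_padic_abs CARD('p) (X n)) * lim (\<lambda>n. rat_padic_abs CARD('p) (Y n))"
    unfolding padic.nm_mult by (intro limI tendsto_mult padic.cau_lim *)
qed

lemma padic_abs_1 [simp]: "padic_abs (1 :: 'p::prime_card padic) = 1"
  by transfer simp

text \<open>The absolute value extends the one on the rationals, the rationals are dense, and
  the space is complete.\<close>

lemma of_rat_padic: "(of_rat q :: 'p::prime_card padic) = Padic (\<lambda>_. q)"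
proof -
  have *: "padic_rel TYPE('p) (\<lambda>_. r) (\<lambda>_. r)" for r
    by (simp add: padic_rel_iff)
  have int: "(of_int k :: 'p padic) = Padic (\<lambda>_. of_int k)" for k
  proof (cases k)
    case (nonneg n)
    then show ?thesis using of_nat_padic[of n, where 'p = 'p] by simp
  next
    case (neg n)
    have "- (Padic (\<lambda>_. of_nat (Suc n)) :: 'p padic) = Padic (\<lambda>_. - of_nat (Suc n))"
      by (rule uminus_padic.abs_eq) (rule *)
    then show ?thesis
      using neg of_nat_padic[of "Suc n", where 'p = 'p] by (simp del: of_nat_Suc)
  qed
  obtain a b where q: "b \<noteq> 0" "q = of_int a / of_int b"
    by (rule padic.rat_cases_frac)
  have "(Padic (\<lambda>_. q) :: 'p padic) * Padic (\<lambda>_. of_int b) = Padic (\<lambda>_. q * of_int b)"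
    by (rule times_padic.abs_eq) (rule *)+
  also have "q * of_int b = of_int a"
    using q by simp
  finally have "Padic (\<lambda>_. q) * (of_int b :: 'p padic) = of_int a"
    by (simp only: int)
  then have "Padic (\<lambda>_. q) = (of_int a / of_int b :: 'p padic)"
    using q(1) by (simp add: eq_divide_eq)
  also have "\<dots> = of_rat q"
    unfolding q(2) by (simp add: of_rat_divide)
  finally show ?thesis by (rule sym)
qed

lemma padic_abs_of_rat: "padic_abs (of_rat q :: 'p::prime_card padic) = rat_padic_abs CARD('p) q"
  by (simp add: of_rat_padic padic_abs.abs_eq padic_rel_iff)

lemma tendsto_Padic:
  assumes X: "padic_prime.cau CARD('p) X"
  shows "(\<lambda>n. of_rat (X n)) \<longlonglongrightarrow> (Padic X :: 'p::prime_card padic)"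
proof (rule metric_LIMSEQ_I)
  fix e :: real assume e: "e > 0"
  obtain N where N: "\<And>m n. m \<ge> N \<Longrightarrow> n \<ge> N \<Longrightarrow> rat_padic_abs CARD('p) (X m - X n) < e / 2"
    using X e unfolding padic.cau_def by (meson half_gt_zero)
  have "dist (of_rat (X n)) (Padic X :: 'p padic) < e" if n: "n \<ge> N" for n
  proof -
    have cau: "padic_prime.cau CARD('p) (\<lambda>m. X n + - X m)"
      using X by (intro padic.cau_add padic.cau_minus padic.cau_const)
    have "of_rat (X n) - (Padic X :: 'p padic) = Padic (\<lambda>m. X n + - X m)"
      using X by (simp add: of_rat_padic minus_padic_def uminus_padic.abs_eq plus_padic.abs_eq
          padic_rel_iff padic.cau_minus)
    then have "dist (of_rat (X n)) (Padic X :: 'p padic)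
        = lim (\<lambda>m. rat_padic_abs CARD('p) (X n + - X m))"
      using cau by (simp add: dist_padic_def padic_abs.abs_eq padic_rel_iff)
    also have "\<dots> \<le> e / 2"
      by (rule LIMSEQ_le_const2[OF padic.cau_lim[OF cau]])
        (use N n in \<open>auto intro!: exI[of _ N] less_imp_le\<close>)
    finally show ?thesis using e by simp
  qed
  then show "\<exists>N. \<forall>n\<ge>N. dist (of_rat (X n)) (Padic X :: 'p padic) < e" by blast
qed

lemma Padic_surj:
  obtains X where "padic_prime.cau CARD('p) X" "(x :: 'p::prime_card padic) = Padic X"
proof
  show "padic_prime.cau CARD('p) (rep_padic x)"
    using Quotient3_rel_rep[OF Quotient3_padic, of x x] by (simp add: padic_rel_iff)
  show "x = Padic (rep_padic x)"
    by (simp add: Quotient3_abs_rep[OF Quotient3_padic])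
qed

lemma padic_rat_dense:
  assumes "e > 0"
  shows "\<exists>q. dist (of_rat q) (x :: 'p::prime_card padic) < e"
proof -
  obtain X where X: "padic_prime.cau CARD('p) X" "x = Padic X" by (rule Padic_surj)
  from metric_LIMSEQ_D[OF tendsto_Padic[OF X(1)] assms] show ?thesis
    unfolding X(2) by blast
qed

instance padic :: (prime_card) complete_space
proof
  fix x :: "nat \<Rightarrow> 'a padic" assume x: "Cauchy x"
  have "\<forall>n. \<exists>q. dist (of_rat q) (x n) < inverse (real (Suc n))"
    by (intro allI padic_rat_dense) simp
  then obtain q where q: "\<And>n. dist (of_rat (q n)) (x n) < inverse (real (Suc n))"
    by metis
  have "(\<lambda>n. dist (of_rat (q n)) (x n)) \<longlonglongrightarrow> 0"
    by (rule real_tendsto_sandwich[OF _ _ tendsto_const LIMSEQ_inverse_real_of_nat])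
      (use q in \<open>auto intro!: always_eventually less_imp_le\<close>)
  then have close: "\<exists>N. \<forall>n\<ge>N. dist (of_rat (q n)) (x n) < e" if "e > 0" for e
    using that by (auto dest!: order_tendstoD(2) simp: eventually_sequentially)
  have "padic_prime.cau CARD('a) q"
    unfolding padic.cau_def
  proof (intro allI impI)
    fix e :: real assume e: "e > 0"
    obtain N where N: "\<And>n. n \<ge> N \<Longrightarrow> dist (of_rat (q n)) (x n) < e / 3"
      using close[of "e / 3"] e by auto
    obtain M where M: "\<And>m n. m \<ge> M \<Longrightarrow> n \<ge> M \<Longrightarrow> dist (x m) (x n) < e / 3"
      using x e unfolding Cauchy_def by (meson divide_pos_pos zero_less_numeral)
    have "rat_padic_abs CARD('a) (q m - q n) < e" if "m \<ge> max M N" "n \<ge> max M N" for m n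
    proof -
      have "rat_padic_abs CARD('a) (q m - q n) = dist (of_rat (q m)) (of_rat (q n) :: 'a padic)"
        by (simp add: dist_padic_def padic_abs_of_rat flip: of_rat_diff)
      also have "\<dots> \<le> dist (of_rat (q m)) (x m) + dist (x m) (x n) + dist (x n) (of_rat (q n))"
        by (meson add_right_mono dist_triangle order_trans)
      also have "\<dots> < e"
        using N[of m] N[of n] M[of m n] that by (simp add: dist_commute)
      finally show ?thesis .
    qed
    then show "\<exists>N. \<forall>m\<ge>N. \<forall>n\<ge>N. rat_padic_abs CARD('a) (q m - q n) < e" by blast
  qed
  from tendsto_Padic[OF this] have lim: "(\<lambda>n. of_rat (q n)) \<longlonglongrightarrow> (Padic q :: 'a padic)" .
  have "x \<longlonglongrightarrow> Padic q"
  proof (rule metric_LIMSEQ_I)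
    fix e :: real assume e: "e > 0"
    obtain N where N: "\<And>n. n \<ge> N \<Longrightarrow> dist (of_rat (q n)) (x n) < e / 2"
      using close[of "e / 2"] e by auto
    obtain M where M: "\<And>n. n \<ge> M \<Longrightarrow> dist (of_rat (q n)) (Padic q :: 'a padic) < e / 2"
      using metric_LIMSEQ_D[OF lim, of "e / 2"] e by auto
    have "dist (x n) (Padic q) < e" if "n \<ge> max M N" for n
      using N[of n] M[of n] that dist_triangle2[of "x n" "Padic q" "of_rat (q n)"]
        dist_triangle[of "x n" "Padic q" "of_rat (q n)"] by (simp add: dist_commute)
    then show "\<exists>N. \<forall>n\<ge>N. dist (x n) (Padic q) < e" by blast
  qed
  then show "convergent x" by (rule convergentI)
qed


section \<open>The ring of \<open>p\<close>-adic integers\<close>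

typedef (overloaded) ('p::prime_card) padic_int = "{x :: 'p padic. padic_abs x \<le> 1}"
  morphisms of_padic_int Padic_Int
  by (rule exI[of _ 0]) simp

setup_lifting type_definition_padic_int

instantiation padic_int :: (prime_card) idom_divide
begin

lift_definition zero_padic_int :: "'a padic_int" is 0 by simp

lift_definition one_padic_int :: "'a padic_int" is 1 by simp

lift_definition plus_padic_int :: "'a padic_int \<Rightarrow> 'a padic_int \<Rightarrow> 'a padic_int" is "(+)"
  by (rule order_trans[OF padic_abs_add_le_max]) simp

lift_definition uminus_padic_int :: "'a padic_int \<Rightarrow> 'a padic_int" is uminus by simp

lift_definition minus_padic_int :: "'a padic_int \<Rightarrow> 'a padic_int \<Rightarrow> 'a padic_int" is "(-)"
  unfolding diff_conv_add_uminus by (rule order_trans[OF padic_abs_add_le_max]) simp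

lift_definition times_padic_int :: "'a padic_int \<Rightarrow> 'a padic_int \<Rightarrow> 'a padic_int" is "(*)"
  by (simp add: padic_abs_mult mult_le_one)

(* Division is exact division where that is possible; the value 0 elsewhere is immaterial. *)
lift_definition divide_padic_int :: "'a padic_int \<Rightarrow> 'a padic_int \<Rightarrow> 'a padic_int"
  is "\<lambda>x y. if padic_abs (x / y) \<le> 1 then x / y else 0"
  by simp

instance
proof
  fix a b c :: "'a padic_int"
  show "a + b = b + a" by transfer (rule add.commute)
  show "(a + b) + c = a + (b + c)" by transfer (rule add.assoc)
  show "0 + a = a" by transfer simp
  show "- a + a = 0" by transfer simp
  show "a - b = a + - b" by transfer simp
  show "(a * b) * c = a * (b * c)" by transfer (rule mult.assoc)
  show "a * b = b * a" by transfer (rule mult.commute)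
  show "1 * a = a" by transfer simp
  show "(a + b) * c = a * c + b * c" by transfer (rule distrib_right)
  show "(0::'a padic_int) \<noteq> 1" by transfer simp
  show "a \<noteq> 0 \<Longrightarrow> b \<noteq> 0 \<Longrightarrow> a * b \<noteq> 0" by transfer simp
  show "b \<noteq> 0 \<Longrightarrow> a * b div b = a" by transfer simp
  show "a div 0 = 0" by transfer simp
  show "0 * a = 0" by transfer simp
  show "a * 0 = 0" by transfer simp
  show "a * (b + c) = a * b + a * c" by transfer (rule distrib_left)
  show "a + b - a = b" by transfer simp
  show "a - b - c = a - (b + c)" by transfer simp
  show "a * (b - c) = a * b - a * c" by transfer (rule right_diff_distrib)
qed

end


section \<open>Maps on subsets of the \<open>p\<close>-adic numbers\<close>

text \<open>Throughout, a map \<open>X \<rightarrow> X\<close> is a total function of which only the values on \<open>X\<close> matter.\<close>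

(* Coprimality is that of the ring of polynomials over the p-adic integers. *)
definition rational_function_on ::
    "'p::prime_card padic set \<Rightarrow> ('p padic \<Rightarrow> 'p padic) \<Rightarrow> bool"
  where "rational_function_on X f \<longleftrightarrow>
    f ` X \<subseteq> X \<and>
    (\<exists>P Q :: 'p padic_int poly. coprime P Q \<and> Q \<noteq> 0 \<and>
      (\<forall>x\<in>X. poly (map_poly of_padic_int Q) x \<noteq> 0 \<and>
        f x = poly (map_poly of_padic_int P) x / poly (map_poly of_padic_int Q) x))"

definition locally_1_Lipschitz_on ::
    "'p::prime_card padic set \<Rightarrow> ('p padic \<Rightarrow> 'p padic) \<Rightarrow> bool"
  where "locally_1_Lipschitz_on X f \<longleftrightarrow>
    (\<forall>a\<in>X. \<exists>r>0. \<forall>x \<in> cball a r \<inter> X. \<forall>y \<in> cball a r \<inter> X.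
      padic_abs (f x - f y) \<le> padic_abs (x - y))"

definition locally_isometric_on ::
    "'p::prime_card padic set \<Rightarrow> ('p padic \<Rightarrow> 'p padic) \<Rightarrow> bool"
  where "locally_isometric_on X f \<longleftrightarrow>
    (\<forall>a\<in>X. \<exists>r>0. \<forall>x \<in> cball a r \<inter> X. \<forall>y \<in> cball a r \<inter> X.
      padic_abs (f x - f y) = padic_abs (x - y))"

definition invertible_on :: "'p::prime_card padic set \<Rightarrow> ('p padic \<Rightarrow> 'p padic) \<Rightarrow> bool"
  where "invertible_on X f \<longleftrightarrow> bij_betw f X X"

(* A translation invariant Borel measure giving every ball of radius p^k the mass p^k;
   these values make it locally finite and determine it uniquely. *)
definition normalized_Haar_measure :: "'p::prime_card padic measure \<Rightarrow> bool"
  where "normalized_Haar_measure \<mu> \<longleftrightarrow>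
    sets \<mu> = sets borel \<and>
    (\<forall>a. \<forall>A \<in> sets borel. emeasure \<mu> ((+) a ` A) = emeasure \<mu> A) \<and>
    (\<forall>a. \<forall>k::int. emeasure \<mu> (cball a (real CARD('p) powi k)) = ennreal (real CARD('p) powi k))"

(* Measurability of the preimage is required explicitly because emeasure is 0 on
   non-measurable sets. *)
definition measure_preserving_on ::
    "'p::prime_card padic measure \<Rightarrow> 'p padic set \<Rightarrow> ('p padic \<Rightarrow> 'p padic) \<Rightarrow> bool"
  where "measure_preserving_on \<mu> X f \<longleftrightarrow>
    (\<forall>A \<in> sets borel. A \<subseteq> X \<longrightarrow>
      f -` A \<inter> X \<in> sets borel \<and> emeasure \<mu> (f -` A \<inter> X) = emeasure \<mu> A)"


section \<open>The digraph of a map\<close>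

text \<open>The vertices are the closed balls of radius \<open>r\<close> around points of \<open>X\<close> themselves. By the
  ultrametric inequality, balls of equal radius coincide or are disjoint, so these are the pieces
  of the partition of \<open>X\<close> whenever they are contained in \<open>X\<close>.\<close>

definition ball_digraph ::
    "'p::prime_card padic set \<Rightarrow> ('p padic \<Rightarrow> 'p padic) \<Rightarrow> real \<Rightarrow> 'p padic set pair_pre_digraph"
  where "ball_digraph X f r =
    \<lparr> pverts = (\<lambda>a. cball a r) ` X,
      parcs = {(D, E). D \<in> (\<lambda>a. cball a r) ` X \<and> E \<in> (\<lambda>a. cball a r) ` X \<and> f ` D \<subseteq> E} \<rparr>"

(* A digraph consisting of exactly one directed cycle; as in the library, a loop is a cycle. *)
definition cycle_digraph :: "'v pair_pre_digraph \<Rightarrow> bool"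
  where "cycle_digraph H \<longleftrightarrow>
    (\<exists>c. pre_digraph.cycle (with_proj H) c \<and> parcs H = set c \<and> pverts H = fst ` set c)"

definition disjoint_union_of_cycles :: "'v pair_pre_digraph \<Rightarrow> bool"
  where "disjoint_union_of_cycles G \<longleftrightarrow>
    (\<exists>\<C>. (\<forall>H\<in>\<C>. cycle_digraph H) \<and>
      pairwise (\<lambda>H K. disjnt (pverts H) (pverts K)) \<C> \<and>
      pverts G = (\<Union>H\<in>\<C>. pverts H) \<and>
      parcs G = (\<Union>H\<in>\<C>. parcs H))"

end

theory Submission
  imports Defs "HOL-Combinatorics.Orbits"
begin

text \<open>At every scale \<open>t \<le> l\<close> the map induces a self-map of the finite set of balls of radius
  \<open>p\<^sup>t\<close> in \<open>X\<close>. Each of the four conditions is equivalent to all these self-maps being surjective,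
  that is, to density of \<open>f(X)\<close> in \<open>X\<close>. By finiteness surjective self-maps are permutations: they
  split into cycles, they keep points apart at distance more than \<open>p\<^sup>t\<close> (so that the
  1-Lipschitz bound becomes an equality), and preimages of balls are balls of the same radius,
  which determines the image measure. A measure-preserving map hits every ball because balls have
  positive measure.\<close>

section \<open>Permutations as unions of cycles\<close>

text \<open>The starting exponent \<open>k\<close> varies so that the induction can remove the first
  arc; the cycle below needs \<open>k = 0\<close>.\<close>

lemma pcas_map_funpow:
  "pcas ((f ^^ k) x) (map (\<lambda>i. ((f ^^ i) x, (f ^^ Suc i) x)) [k..<k + n]) ((f ^^ (k + n)) x)"
proof (induction n arbitrary: k)
  case (Suc n)
  have "[k..<k + Suc n] = k # [Suc k..<Suc k + n]"
    by (simp add: upt_conv_Cons del: upt_Suc)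
  with Suc[of "Suc k"] show ?case
    by (simp del: upt_Suc)
qed simp

lemma pawalk_verts_pcas: "pcas u c v \<Longrightarrow> pawalk_verts u c = u # map snd c"
  by (induction c arbitrary: u) auto

text \<open>The head of an arc is the tail of the next one, or the end of the walk. With the next
  two lemmas, the heads and tails of a nonempty closed walk form the same set.\<close>

lemma pcas_snd_subset: "pcas u c v \<Longrightarrow> snd ` set c \<subseteq> insert v (fst ` set c)"
proof (induction c arbitrary: u)
  case (Cons e c)
  then show ?case by (cases c) auto
qed simp

lemma pcas_fst_subset: "pcas u c v \<Longrightarrow> fst ` set c \<subseteq> insert u (snd ` set c)"
proof (induction c arbitrary: u)
  case (Cons e c)
  then show ?case by (auto dest!: Cons.IH)
qed simp

lemma pcas_last: "pcas u c v \<Longrightarrow> c \<noteq> [] \<Longrightarrow> v \<in> snd ` set c"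
proof (induction c arbitrary: u)
  case (Cons e c)
  then show ?case by (cases c) auto
qed simp

text \<open>The walk is closed and nonempty, so its start is also a head. Hence every vertex has an
  incoming arc, which will give surjectivity.\<close>

lemma cycle_digraph_pverts: "cycle_digraph H \<Longrightarrow> pverts H \<subseteq> snd ` parcs H"
  unfolding cycle_digraph_def pre_digraph.cycle_def pre_digraph.awalk_def cas_with_proj_eq
  by (metis insert_absorb pcas_fst_subset pcas_last)

text \<open>The cycle runs through the orbit of a point \<open>s\<close> until the first return to
  \<open>s\<close>, after \<open>n\<close> steps.\<close>

lemma cyclic_on_cycle_digraph:
  assumes "cyclic_on f S"
  shows "cycle_digraph \<lparr>pverts = S, parcs = (\<lambda>x. (x, f x)) ` S\<rparr>"
proof -
  obtain s where s: "s \<in> S" "S = orbit f s"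
    using assms by (auto simp: cyclic_on_def)
  then have self: "s \<in> orbit f s" by simp
  define n where "n = funpow_dist1 f s s"
  define c where "c = map (\<lambda>i. ((f ^^ i) s, (f ^^ Suc i) s)) [0..<n]"
  have n: "(f ^^ n) s = s" "0 < n"
    using funpow_dist1_prop[OF self] by (simp_all add: n_def)
  have S: "S = (\<lambda>i. (f ^^ i) s) ` {0..<n}"
    using orbit_conv_funpow_dist1[OF self] by (simp add: s n_def)
  have card: "card S = n"
    unfolding S using inj_on_funpow_dist1[OF self] by (simp add: card_image n_def)
  have fst: "fst ` set c = S"
    by (simp add: c_def S image_image)
  have parcs: "(\<lambda>x. (x, f x)) ` S = set c"
    by (simp add: c_def S image_image)
  have pcas: "pcas s c s"
    using pcas_map_funpow[of 0 f s n] n by (simp add: c_def)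
  have "c \<noteq> []" using n by (simp add: c_def)
  have snd: "snd ` set c = S"
    using pcas_snd_subset[OF pcas] pcas_fst_subset[OF pcas] pcas_last[OF pcas \<open>c \<noteq> []\<close>] fst s
    by auto
  \<comment> \<open>No vertex repeats, by counting: the \<open>n\<close> heads exhaust the set
    \<open>S\<close> of \<open>n\<close> elements.\<close>
  have "card (set (map snd c)) = length (map snd c)"
    unfolding set_map snd card by (simp add: c_def)
  then have "distinct (map snd c)" by (rule card_distinct)
  then have "pre_digraph.cycle (with_proj \<lparr>pverts = S, parcs = (\<lambda>x. (x, f x)) ` S\<rparr>) c"
    unfolding pre_digraph.cycle_def pre_digraph.awalk_def cas_with_proj_eq awalk_verts_with_proj_eq
    using pcas \<open>c \<noteq> []\<close> s(1) by (intro exI[of _ s]) (simp add: pawalk_verts_pcas[OF pcas] parcs)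
  then show ?thesis
    unfolding cycle_digraph_def using fst parcs by auto
qed

text \<open>Heads of arcs are values of \<open>F\<close>, so cycles covering \<open>V\<close> force
  surjectivity. Conversely, a surjection of a finite set onto itself is a permutation, and its
  orbits are the cycles.\<close>

lemma disjoint_union_of_cycles_function_digraph:
  assumes "finite V" "F ` V \<subseteq> V"
  shows "disjoint_union_of_cycles \<lparr>pverts = V, parcs = (\<lambda>x. (x, F x)) ` V\<rparr> \<longleftrightarrow> F ` V = V"
proof
  assume "disjoint_union_of_cycles \<lparr>pverts = V, parcs = (\<lambda>x. (x, F x)) ` V\<rparr>"
  then obtain \<C> where \<C>: "\<forall>H\<in>\<C>. cycle_digraph H" "V = (\<Union>H\<in>\<C>. pverts H)"
    "(\<lambda>x. (x, F x)) ` V = (\<Union>H\<in>\<C>. parcs H)"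
    unfolding disjoint_union_of_cycles_def pair_pre_digraph.select_convs by blast
  note \<C>(2)
  also have "(\<Union>H\<in>\<C>. pverts H) \<subseteq> (\<Union>H\<in>\<C>. snd ` parcs H)"
    using \<C>(1) cycle_digraph_pverts by (intro UN_mono) auto
  also have "\<dots> = snd ` (\<lambda>x. (x, F x)) ` V"
    unfolding \<C>(3) by (rule image_UN[symmetric])
  finally show "F ` V = V"
    using assms(2) by (auto simp: image_image)
next
  assume surj: "F ` V = V"
  then have bij: "bij_betw F V V"
    using assms(1) by (simp add: bij_betw_def eq_card_imp_inj_on)
  \<comment> \<open>Off \<open>V\<close> the map becomes the identity, as \<open>permutes\<close>
    demands of a total function.\<close>
  define g where "g = perm_restrict F V"
  have "g permutes V"
    unfolding g_def
  proof (rule bij_imp_permutes)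
    show "bij_betw (perm_restrict F V) V V"
      using bij by (simp add: perm_restrict_def cong: bij_betw_cong)
  qed (simp add: perm_restrict_def)
  then obtain C where C: "\<And>c. c \<in> C \<Longrightarrow> cyclic_on g c" "\<Union>C = V"
    "\<And>c1 c2. c1 \<in> C \<Longrightarrow> c2 \<in> C \<Longrightarrow> c1 \<noteq> c2 \<Longrightarrow> c1 \<inter> c2 = {}"
    using permutes_decompose[OF _ assms(1)] by metis
  have "(\<lambda>x. (x, F x)) ` V = (\<lambda>x. (x, g x)) ` V"
    by (simp add: g_def perm_restrict_def)
  then have parcs: "(\<lambda>x. (x, F x)) ` V = (\<Union>c\<in>C. (\<lambda>x. (x, g x)) ` c)"
    unfolding C(2)[symmetric] by (simp only: image_Union)
  define \<C> where "\<C> = (\<lambda>c. \<lparr>pverts = c, parcs = (\<lambda>x. (x, g x)) ` c\<rparr>) ` C"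
  have "pairwise (\<lambda>H K. disjnt (pverts H) (pverts K)) \<C>"
    using C(3) unfolding \<C>_def pairwise_def disjnt_def by fastforce
  moreover have "\<forall>H\<in>\<C>. cycle_digraph H"
    using C(1) cyclic_on_cycle_digraph by (auto simp: \<C>_def)
  ultimately show "disjoint_union_of_cycles \<lparr>pverts = V, parcs = (\<lambda>x. (x, F x)) ` V\<rparr>"
    unfolding disjoint_union_of_cycles_def parcs using C(2)
    by (intro exI[of _ \<C>]) (auto simp: \<C>_def)
qed

section \<open>The ultrametric geometry of the \<open>p\<close>-adic numbers\<close>

lemma padic_dist_le_max: "dist x z \<le> max (dist x y) (dist y (z :: 'p::prime_card padic))"
  using padic_abs_add_le_max[of "x - y" "y - z"] by (simp add: dist_padic_def)

lemma padic_dist_le_trans: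
  "dist x y \<le> r \<Longrightarrow> dist y z \<le> r \<Longrightarrow> dist x (z :: 'p::prime_card padic) \<le> r"
  using padic_dist_le_max[of x z y] by simp

lemma padic_cball_eq_iff:
  assumes "r \<ge> 0"
  shows "cball a r = cball b r \<longleftrightarrow> dist a (b :: 'p::prime_card padic) \<le> r"
proof
  assume "cball a r = cball b r"
  then have "b \<in> cball a r" using assms by simp
  then show "dist a b \<le> r" by simp
next
  assume ab: "dist a b \<le> r"
  then have ba: "dist b a \<le> r" by (simp add: dist_commute)
  show "cball a r = cball b r"
    using padic_dist_le_trans[OF ab] padic_dist_le_trans[OF ba] by auto
qed

text \<open>By the ultrametric inequality a closed ball is centred at each of its points, so it
  contains an open ball around each of them.\<close>

lemma padic_open_cball:
  assumes "r > 0"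
  shows "open (cball (a :: 'p::prime_card padic) r)"
  unfolding open_contains_ball
proof
  fix x assume "x \<in> cball a r"
  then have "cball x r = cball a r"
    using assms by (simp add: padic_cball_eq_iff dist_commute)
  then show "\<exists>e>0. ball x e \<subseteq> cball a r"
    using assms ball_subset_cball by blast
qed

text \<open>On nonzero rationals the absolute value is a power of \<open>p\<close> by definition. A
  rational \<open>q\<close> closer to \<open>z = x - y\<close> than \<open>padic_abs z\<close> has
  the same absolute value as \<open>z\<close>, by the ultrametric inequality.\<close>

lemma padic_dist_powi:
  assumes "x \<noteq> (y :: 'p::prime_card padic)"
  obtains k :: int where "dist x y = real CARD('p) powi k"
proof -
  define z where "z = x - y"
  have z: "padic_abs z > 0"
    using assms padic_abs_nonneg[of z] by (auto simp: z_def less_le)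
  then obtain q where q: "padic_abs (of_rat q - z) < padic_abs z"
    using padic_rat_dense[of "padic_abs z" z] by (auto simp: dist_padic_def)
  have "padic_abs z \<le> max (padic_abs (z - of_rat q)) (padic_abs (of_rat q :: 'p padic))"
    using padic_abs_add_le_max[of "z - of_rat q" "of_rat q"] by simp
  moreover have "padic_abs (z - of_rat q) = padic_abs (of_rat q - z)"
    using padic_abs_minus[of "z - of_rat q"] by simp
  moreover have "padic_abs (of_rat q :: 'p padic) \<le> max (padic_abs (of_rat q - z)) (padic_abs z)"
    using padic_abs_add_le_max[of "of_rat q - z" z] by simp
  ultimately have eq: "padic_abs z = rat_padic_abs CARD('p) q"
    using q by (simp add: padic_abs_of_rat)
  then have "q \<noteq> 0" using z by auto
  then show ?thesis
    using eq by (intro that) (simp add: dist_padic_def z_def rat_padic_abs_def)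
qed

lemma prime_card_gt_1: "real CARD('p::prime_card) > 1"
  by (rule padic.p_gt_1)

text \<open>The scales at most \<open>l\<close> thus suffice for every epsilon argument.\<close>

lemma powi_radius_less:
  assumes "e > 0"
  obtains n :: nat where "real CARD('p::prime_card) powi (l - int n) < e"
proof -
  let ?P = "real CARD('p)"
  have P: "?P > 1" by (rule prime_card_gt_1)
  then obtain n where n: "(1 / ?P) ^ n < e / ?P powi l"
    using real_arch_pow_inv[of "e / ?P powi l" "1 / ?P"] assms by auto
  have "?P powi (l - int n) = ?P powi l * (1 / ?P) ^ n"
    using P by (simp add: power_int_diff power_one_over)
  also have "\<dots> < e"
    using n P by (simp add: pos_less_divide_eq mult.commute)
  finally show ?thesis by (rule that)
qed

section \<open>The induced map on balls of a fixed radius\<close>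

text \<open>The Lipschitz condition needs no centre here: two points lie in a common ball of radius
  \<open>r\<close> exactly when their distance is at most \<open>r\<close>.\<close>

locale nonexpanding_at_scale =
  fixes X :: "'p::prime_card padic set" and f :: "'p padic \<Rightarrow> 'p padic" and r :: real
  assumes radius_pos: "r > 0"
    and compact_domain: "compact X"
    and maps_to: "f ` X \<subseteq> X"
    and cball_subset: "a \<in> X \<Longrightarrow> cball a r \<subseteq> X"
    and nonexpanding: "x \<in> X \<Longrightarrow> y \<in> X \<Longrightarrow> dist x y \<le> r \<Longrightarrow> dist (f x) (f y) \<le> dist x y"
begin

definition balls :: "'p padic set set"
  where "balls = (\<lambda>a. cball a r) ` X"

text \<open>For \<open>D\<close> in \<open>balls\<close> all balls in this union coincide
  (\<open>ball_map_cball\<close>); the union avoids choosing a centre of \<open>D\<close>.\<close>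

definition ball_map :: "'p padic set \<Rightarrow> 'p padic set"
  where "ball_map D = (\<Union>a\<in>D. cball (f a) r)"

text \<open>Surjectivity of \<open>ball_map\<close> on \<open>balls\<close> in terms of points; see
  \<open>surj_ball_map_iff\<close>.\<close>

definition meets_all_balls :: bool
  where "meets_all_balls \<longleftrightarrow> (\<forall>y\<in>X. \<exists>x\<in>X. dist (f x) y \<le> r)"

lemma cball_eq_iff: "cball a r = cball b r \<longleftrightarrow> dist a (b :: 'p padic) \<le> r"
  using radius_pos by (simp add: padic_cball_eq_iff)

lemma ball_map_cball:
  assumes "a \<in> X"
  shows "ball_map (cball a r) = cball (f a) r"
proof -
  have "cball (f b) r = cball (f a) r" if "b \<in> cball a r" for b
  proof -
    have "dist (f a) (f b) \<le> dist a b"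
      using that assms cball_subset[OF assms] by (intro nonexpanding) auto
    then show ?thesis
      using that by (simp add: cball_eq_iff dist_commute)
  qed
  moreover have "a \<in> cball a r" using radius_pos by simp
  ultimately show ?thesis
    unfolding ball_map_def by blast
qed

lemma ball_map_balls: "ball_map ` balls = (\<lambda>a. cball (f a) r) ` X"
  by (simp add: balls_def image_image ball_map_cball)

lemma ball_map_balls_subset: "ball_map ` balls \<subseteq> balls"
  unfolding ball_map_balls using maps_to by (auto simp: balls_def)

text \<open>Finitely many of the open sets \<open>cball a r\<close> cover the compact set
  \<open>X\<close>, and any ball centred in \<open>X\<close> equals the covering ball that contains
  its centre.\<close>

lemma finite_balls: "finite balls"
proof -
  have "X \<subseteq> (\<Union>a\<in>X. cball a r)"
    using radius_pos by auto
  then obtain C where C: "C \<subseteq> X" "finite C" "X \<subseteq> (\<Union>a\<in>C. cball a r)"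
    using compactE_image[OF compact_domain, of X "\<lambda>a. cball a r"] padic_open_cball[OF radius_pos]
    by metis
  have "balls \<subseteq> (\<lambda>a. cball a r) ` C"
    unfolding balls_def
  proof
    fix D assume "D \<in> (\<lambda>a. cball a r) ` X"
    then obtain a where a: "a \<in> X" "D = cball a r" by blast
    then obtain c where "c \<in> C" "a \<in> cball c r" using C by blast
    then show "D \<in> (\<lambda>a. cball a r) ` C"
      using a cball_eq_iff by auto
  qed
  then show ?thesis
    using C(2) finite_surj by blast
qed

lemma surj_ball_map_iff: "ball_map ` balls = balls \<longleftrightarrow> meets_all_balls"
proof -
  have "ball_map ` balls = balls \<longleftrightarrow> balls \<subseteq> ball_map ` balls"
    using ball_map_balls_subset by blast
  also have "\<dots> \<longleftrightarrow> (\<forall>y\<in>X. \<exists>x\<in>X. cball y r = cball (f x) r)"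
    unfolding ball_map_balls unfolding balls_def by blast
  finally show ?thesis
    by (simp add: cball_eq_iff meets_all_balls_def dist_commute)
qed

text \<open>A ball of radius \<open>r\<close> is determined by any of its points, here
  \<open>f a\<close> with \<open>a\<close> in \<open>D\<close>. So each \<open>D\<close> has exactly
  one possible target, and the criterion for digraphs of functions applies.\<close>

lemma ball_digraph_eq:
  "ball_digraph X f r = \<lparr>pverts = balls, parcs = (\<lambda>D. (D, ball_map D)) ` balls\<rparr>"
proof -
  have "f ` cball a r \<subseteq> cball b r \<longleftrightarrow> cball b r = ball_map (cball a r)" if "a \<in> X" for a b
  proof
    assume "f ` cball a r \<subseteq> cball b r"
    moreover have "a \<in> cball a r" using radius_pos by simp
    ultimately have "f a \<in> cball b r" by blast
    then show "cball b r = ball_map (cball a r)"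
      using that by (simp add: ball_map_cball cball_eq_iff)
  next
    assume b: "cball b r = ball_map (cball a r)"
    show "f ` cball a r \<subseteq> cball b r"
      unfolding b ball_map_def using radius_pos by auto
  qed
  then have "f ` D \<subseteq> E \<longleftrightarrow> E = ball_map D" if "D \<in> balls" "E \<in> balls" for D E
    using that by (auto simp: balls_def)
  then have "{(D, E). D \<in> balls \<and> E \<in> balls \<and> f ` D \<subseteq> E} = (\<lambda>D. (D, ball_map D)) ` balls"
    using ball_map_balls_subset by blast
  then show ?thesis
    by (simp add: ball_digraph_def balls_def)
qed

lemma disjoint_union_of_cycles_iff:
  "disjoint_union_of_cycles (ball_digraph X f r) \<longleftrightarrow> meets_all_balls"
  unfolding ball_digraph_eq surj_ball_map_iff[symmetric]
  by (rule disjoint_union_of_cycles_function_digraph[OF finite_balls ball_map_balls_subset])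

section \<open>Injectivity on balls and preimages of balls\<close>

lemma inj_on_ball_map: "meets_all_balls \<Longrightarrow> inj_on ball_map balls"
  using surj_ball_map_iff finite_balls by (simp add: eq_card_imp_inj_on)

text \<open>Injectivity of the induced map: points have images in a common ball only if they share a
  ball themselves.\<close>

lemma dist_le_iff:
  assumes "meets_all_balls" "x \<in> X" "y \<in> X"
  shows "dist (f x) (f y) \<le> r \<longleftrightarrow> dist x y \<le> r"
proof -
  have "cball (f x) r = cball (f y) r \<longleftrightarrow> cball x r = cball y r"
    using inj_on_eq_iff[OF inj_on_ball_map[OF assms(1)], of "cball x r" "cball y r"] assms(2,3)
    by (simp add: balls_def ball_map_cball)
  then show ?thesis
    by (simp add: cball_eq_iff)
qed

text \<open>Some \<open>f a\<close> lies in \<open>D\<close>, so \<open>D\<close> is the ball around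
  \<open>f a\<close>, and \<open>dist_le_iff\<close> turns closeness to \<open>f a\<close> into
  closeness to \<open>a\<close>.\<close>

lemma vimage_ball:
  assumes "meets_all_balls" "D \<in> balls"
  obtains a where "a \<in> X" "f -` D \<inter> X = cball a r"
proof -
  obtain y where y: "y \<in> X" "D = cball y r"
    using assms(2) by (auto simp: balls_def)
  then obtain a where a: "a \<in> X" "dist (f a) y \<le> r"
    using assms(1) by (auto simp: meets_all_balls_def)
  then have D: "D = cball (f a) r"
    using y by (simp add: cball_eq_iff dist_commute)
  have "f -` D \<inter> X = cball a r"
    using cball_subset[OF a(1)] dist_le_iff[OF assms(1) a(1)] by (auto simp: D)
  with a(1) show ?thesis by (rule that)
qed

lemma continuous_on_domain: "continuous_on X f"
  unfolding continuous_on_iff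
proof (intro ballI allI impI)
  fix x and e :: real assume "x \<in> X" "e > 0"
  have "dist (f y) (f x) < e" if "y \<in> X" "dist y x < min e r" for y
    using nonexpanding[of y x] that \<open>x \<in> X\<close> by simp
  then show "\<exists>d>0. \<forall>y\<in>X. dist y x < d \<longrightarrow> dist (f y) (f x) < e"
    using radius_pos \<open>e > 0\<close> by (intro exI[of _ "min e r"]) simp
qed

lemma disjoint_balls:
  assumes "D \<in> balls" "E \<in> balls" "D \<noteq> E"
  shows "D \<inter> E = {}"
proof -
  have "cball a r = cball x r" if "x \<in> cball a r" for a x :: "'p padic"
    using that by (simp add: cball_eq_iff)
  then show ?thesis
    using assms unfolding balls_def by (smt (verit) disjoint_iff imageE)
qed

text \<open>Finite additivity reduces this to single balls, whose preimages are balls of the same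
  radius. The normalization prescribes the measure for radii that are powers of
  \<open>p\<close>.\<close>

lemma emeasure_vimage_Union_balls:
  assumes \<mu>: "normalized_Haar_measure \<mu>" and r: "r = real CARD('p) powi t"
    and meets: meets_all_balls and \<D>: "\<D> \<subseteq> balls"
  shows "emeasure \<mu> (f -` (\<Union>\<D>) \<inter> X) = emeasure \<mu> (\<Union>\<D>)"
proof -
  have sets: "cball a r \<in> sets \<mu>" for a
    using \<mu> by (simp add: normalized_Haar_measure_def)
  have meas: "emeasure \<mu> (cball a r) = ennreal r" for a
    using \<mu> by (simp add: normalized_Haar_measure_def r)
  have vimage: "f -` D \<inter> X \<in> sets \<mu> \<and> emeasure \<mu> (f -` D \<inter> X) = emeasure \<mu> D" if "D \<in> \<D>" for D
  proof -
    have D: "D \<in> balls" using that \<D> by blast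
    obtain a where "f -` D \<inter> X = cball a r"
      by (rule vimage_ball[OF meets D])
    moreover obtain b where "D = cball b r"
      using D by (auto simp: balls_def)
    ultimately show ?thesis by (simp add: sets meas)
  qed
  have fin: "finite \<D>" using \<D> finite_balls finite_subset by blast
  have disj: "D \<inter> E = {}" if "D \<in> \<D>" "E \<in> \<D>" "D \<noteq> E" for D E
    using that \<D> disjoint_balls by blast
  have "emeasure \<mu> (f -` (\<Union>\<D>) \<inter> X) = emeasure \<mu> (\<Union>D\<in>\<D>. f -` D \<inter> X)"
    by (rule arg_cong[where f = "emeasure \<mu>"]) blast
  also have "\<dots> = (\<Sum>D\<in>\<D>. emeasure \<mu> (f -` D \<inter> X))"
    using vimage disj fin
    by (intro sum_emeasure[symmetric]) (auto simp: disjoint_family_on_def)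
  also have "\<dots> = (\<Sum>D\<in>\<D>. emeasure \<mu> D)"
    using vimage by simp
  also have "\<dots> = emeasure \<mu> (\<Union>D\<in>\<D>. D)"
    using disj fin \<D> sets
    by (intro sum_emeasure) (auto simp: disjoint_family_on_def balls_def)
  finally show ?thesis by simp
qed

end

section \<open>All small scales together\<close>

locale nonexpanding_below_scale =
  fixes X :: "'p::prime_card padic set" and f :: "'p padic \<Rightarrow> 'p padic" and l :: int
  assumes nonexpanding_at:
    "t \<le> l \<Longrightarrow> nonexpanding_at_scale X f (real CARD('p) powi t)"
begin

definition dense_image :: bool
  where "dense_image \<longleftrightarrow> (\<forall>t\<le>l. nonexpanding_at_scale.meets_all_balls X f (real CARD('p) powi t))"

sublocale top_scale: nonexpanding_at_scale X f "real CARD('p) powi l"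
  by (rule nonexpanding_at) simp

lemma dense_imageD: "dense_image \<Longrightarrow> t \<le> l \<Longrightarrow> nonexpanding_at_scale.meets_all_balls X f (real CARD('p) powi t)"
  by (simp add: dense_image_def)

lemma dense_image_iff:
  "dense_image \<longleftrightarrow> (\<forall>t\<le>l. \<forall>y\<in>X. \<exists>x\<in>X. dist (f x) y \<le> real CARD('p) powi t)"
  unfolding dense_image_def
  by (simp add: nonexpanding_at_scale.meets_all_balls_def nonexpanding_at cong: imp_cong)

section \<open>Isometry and bijectivity from density of the image\<close>

text \<open>Points at distance \<open>p^k\<close> lie in different balls of radius
  \<open>p^(k-1)\<close>, hence so do their images. Distances being powers of \<open>p\<close>, the
  images are at least \<open>p^k\<close> apart, and the Lipschitz bound gives equality.\<close>

lemma dense_image_isometric: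
  assumes dense_image "x \<in> X" "y \<in> X" "dist x y \<le> real CARD('p) powi l"
  shows "dist (f x) (f y) = dist x y"
proof (cases "x = y")
  case False
  then obtain k where k: "dist x y = real CARD('p) powi k" by (rule padic_dist_powi)
  have P: "real CARD('p) > 1" by (rule prime_card_gt_1)
  have "k \<le> l"
    using assms(4) power_int_strict_increasing[OF _ P, of l k] by (force simp: k)
  then have "k - 1 \<le> l" by simp
  have "real CARD('p) powi (k - 1) < real CARD('p) powi k"
    using P by (intro power_int_strict_increasing) auto
  then have far: "real CARD('p) powi (k - 1) < dist (f x) (f y)"
    using nonexpanding_at_scale.dist_le_iff[OF nonexpanding_at dense_imageD, OF \<open>k - 1 \<le> l\<close> assms(1) \<open>k - 1 \<le> l\<close> assms(2,3)]
    by (simp add: k)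
  have "real CARD('p) powi (k - 1) > 0" using P by simp
  with far have "dist (f x) (f y) > 0" by (rule less_trans[rotated])
  then have "f x \<noteq> f y" by auto
  then obtain j where j: "dist (f x) (f y) = real CARD('p) powi j" by (rule padic_dist_powi)
  have "\<not> j \<le> k - 1"
    using far P power_int_increasing[of j "k - 1" "real CARD('p)"] by (auto simp: j)
  then have "real CARD('p) powi k \<le> real CARD('p) powi j"
    using P by (intro power_int_increasing) auto
  moreover have "dist (f x) (f y) \<le> dist x y"
    by (rule top_scale.nonexpanding[OF assms(2-4)])
  ultimately show ?thesis by (simp add: j k)
qed simp

lemma dense_image_locally_isometric:
  assumes dense_image
  shows "locally_isometric_on X f"
  unfolding locally_isometric_on_def
proof
  fix a assume "a \<in> X"
  have le: "dist x y \<le> real CARD('p) powi l" if "x \<in> cball a (real CARD('p) powi l)" "y \<in> cball a (real CARD('p) powi l)" for x y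
    using that by (auto intro: padic_dist_le_trans[of x a _ y] simp: dist_commute)
  have "dist (f x) (f y) = dist x y"
    if "x \<in> cball a (real CARD('p) powi l) \<inter> X" "y \<in> cball a (real CARD('p) powi l) \<inter> X" for x y
    by (rule dense_image_isometric[OF assms]) (use that le in blast)+
  then show "\<exists>r>0. \<forall>x \<in> cball a r \<inter> X. \<forall>y \<in> cball a r \<inter> X.
      padic_abs (f x - f y) = padic_abs (x - y)"
    unfolding dist_padic_def[symmetric] using top_scale.radius_pos by blast
qed

text \<open>Distinct points are separated at some small scale, and so are their images. The image is
  compact, hence closed, and dense in \<open>X\<close>.\<close>

lemma dense_image_invertible:
  assumes dense_image
  shows "invertible_on X f"
  unfolding invertible_on_def bij_betw_def
proof
  show "inj_on f X"
  proof (rule inj_onI, rule ccontr)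
    fix x y assume xy: "x \<in> X" "y \<in> X" "f x = f y" "x \<noteq> y"
    obtain n where n: "real CARD('p) powi (l - int n) < dist x y"
      using powi_radius_less[of "dist x y" l, where 'p = 'p] xy by auto
    interpret scale: nonexpanding_at_scale X f "real CARD('p) powi (l - int n)"
      by (rule nonexpanding_at) simp
    have scale.meets_all_balls
      by (rule dense_imageD[OF assms]) simp
    then show False
      using scale.dist_le_iff[OF _ xy(1,2)] scale.radius_pos n xy(3) by simp
  qed
  have "closed (f ` X)"
    using compact_continuous_image[OF top_scale.continuous_on_domain top_scale.compact_domain]
    by (rule compact_imp_closed)
  moreover have "y \<in> closure (f ` X)" if "y \<in> X" for y
    unfolding closure_approachable
  proof (intro allI impI)
    fix e :: real assume "e > 0"
    then obtain n where n: "real CARD('p) powi (l - int n) < e"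
      using powi_radius_less[of e l, where 'p = 'p] by auto
    have "l - int n \<le> l" by simp
    then obtain x where "x \<in> X" "dist (f x) y \<le> real CARD('p) powi (l - int n)"
      using iffD1[OF dense_image_iff assms, rule_format, OF _ \<open>y \<in> X\<close>] by blast
    then show "\<exists>z\<in>f ` X. dist z y < e"
      using n by (intro bexI[of _ "f x"]) auto
  qed
  ultimately show "f ` X = X"
    using top_scale.maps_to by (auto simp: closure_closed)
qed

lemma invertible_dense_image:
  assumes "invertible_on X f"
  shows dense_image
  unfolding dense_image_iff
proof (intro allI impI ballI)
  fix t y assume "y \<in> X"
  then have "y \<in> f ` X"
    using assms by (simp add: invertible_on_def bij_betw_def)
  then obtain x where "x \<in> X" "f x = y" by blast
  then show "\<exists>x\<in>X. dist (f x) y \<le> real CARD('p) powi t"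
    using prime_card_gt_1[where 'p = 'p] by (intro bexI[of _ x]) auto
qed

section \<open>Density of the image and Haar measure\<close>

lemma measure_preserving_dense_image:
  assumes \<mu>: "normalized_Haar_measure \<mu>" and "measure_preserving_on \<mu> X f"
  shows dense_image
  unfolding dense_image_iff
proof (intro allI impI ballI)
  fix t y assume t: "t \<le> l" and y: "y \<in> X"
  have "cball y (real CARD('p) powi t) \<subseteq> X"
    using nonexpanding_at_scale.cball_subset[OF nonexpanding_at[OF t] y] .
  then have "emeasure \<mu> (f -` cball y (real CARD('p) powi t) \<inter> X) = emeasure \<mu> (cball y (real CARD('p) powi t))"
    using assms(2) by (simp add: measure_preserving_on_def)
  also have "\<dots> = ennreal (real CARD('p) powi t)"
    using \<mu> by (simp add: normalized_Haar_measure_def)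
  also have "\<dots> \<noteq> 0"
    using prime_card_gt_1[where 'p = 'p] by (simp add: ennreal_eq_0_iff not_le)
  finally have "f -` cball y (real CARD('p) powi t) \<inter> X \<noteq> {}" by force
  then show "\<exists>x\<in>X. dist (f x) y \<le> real CARD('p) powi t"
    by (auto simp: dist_commute)
qed

lemma open_domain: "open X"
  unfolding open_contains_cball using top_scale.cball_subset top_scale.radius_pos by blast

text \<open>\<open>X\<close> is a finite union of balls of finite measure. Finiteness is required
  for uniqueness of a measure given on open sets.\<close>

lemma emeasure_domain_finite:
  assumes \<mu>: "normalized_Haar_measure \<mu>"
  shows "emeasure \<mu> X < \<infinity>"
proof -
  have fin: "emeasure \<mu> D < \<infinity>" "D \<in> sets \<mu>" if "D \<in> top_scale.balls" for D
    using that \<mu> by (auto simp: top_scale.balls_def normalized_Haar_measure_def)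
  have "X = \<Union>top_scale.balls"
    using top_scale.cball_subset top_scale.radius_pos by (force simp: top_scale.balls_def)
  then have "emeasure \<mu> X = emeasure \<mu> (\<Union>D\<in>top_scale.balls. D)"
    by simp
  also have "\<dots> \<le> (\<Sum>D\<in>top_scale.balls. emeasure \<mu> D)"
    using fin by (intro emeasure_subadditive_finite top_scale.finite_balls) auto
  also have "\<dots> < \<infinity>"
    using fin by (simp add: top_scale.finite_balls)
  finally show ?thesis .
qed

text \<open>Finite unions of ever smaller balls increase to \<open>U \<inter> X\<close>, and their
  preimages increase to the preimage. The equality for unions of balls passes to the limit by
  continuity from below.\<close>

lemma emeasure_vimage_open:
  assumes \<mu>: "normalized_Haar_measure \<mu>" and dense_image and "open U"
  shows "emeasure \<mu> (f -` U \<inter> X) = emeasure \<mu> (U \<inter> X)"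
proof -
  define \<D> where
    "\<D> n = {D \<in> nonexpanding_at_scale.balls X (real CARD('p) powi (l - int n)). D \<subseteq> U}" for n
  have scale: "nonexpanding_at_scale X f (real CARD('p) powi (l - int n))" for n
    by (rule nonexpanding_at) simp
  \<comment> \<open>Recentring each ball at the point \<open>x\<close> gives a description in which
    monotonicity in \<open>n\<close> is visible.\<close>
  have \<D>: "\<Union>(\<D> n) = {x \<in> X. cball x (real CARD('p) powi (l - int n)) \<subseteq> U}" for n
  proof -
    interpret nonexpanding_at_scale X f "real CARD('p) powi (l - int n)" by (rule scale)
    show ?thesis
    proof (intro equalityI subsetI)
      fix x assume "x \<in> \<Union>(\<D> n)"
      then obtain a where a: "a \<in> X" "x \<in> cball a (real CARD('p) powi (l - int n))"
        "cball a (real CARD('p) powi (l - int n)) \<subseteq> U"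
        by (auto simp: \<D>_def balls_def)
      moreover have "cball x (real CARD('p) powi (l - int n)) = cball a (real CARD('p) powi (l - int n))"
        using a(2) unfolding cball_eq_iff by (simp add: dist_commute)
      ultimately show "x \<in> {x \<in> X. cball x (real CARD('p) powi (l - int n)) \<subseteq> U}"
        using cball_subset[of a] by auto
    next
      fix x assume "x \<in> {x \<in> X. cball x (real CARD('p) powi (l - int n)) \<subseteq> U}"
      moreover have "x \<in> cball x (real CARD('p) powi (l - int n))"
        using radius_pos by simp
      ultimately show "x \<in> \<Union>(\<D> n)"
        unfolding \<D>_def balls_def by blast
    qed
  qed
  have "real CARD('p) powi (l - int (Suc n)) \<le> real CARD('p) powi (l - int n)" for n
    using prime_card_gt_1[where 'p = 'p] by (intro power_int_increasing) auto
  then have inc: "incseq (\<lambda>n. \<Union>(\<D> n))"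
    unfolding \<D> by (intro incseq_SucI) (use subset_cball in blast)
  have UX: "(\<Union>n. \<Union>(\<D> n)) = U \<inter> X"
    unfolding \<D>
  proof (intro equalityI subsetI)
    fix x assume x: "x \<in> U \<inter> X"
    then obtain e where e: "e > 0" "cball x e \<subseteq> U"
      using \<open>open U\<close> by (auto simp: open_contains_cball)
    obtain n where "real CARD('p) powi (l - int n) < e"
      using powi_radius_less[OF e(1), of l, where 'p = 'p] by auto
    then have "cball x (real CARD('p) powi (l - int n)) \<subseteq> U"
      using e(2) subset_cball[of "real CARD('p) powi (l - int n)" e x] by simp
    with x show "x \<in> (\<Union>n. {x \<in> X. cball x (real CARD('p) powi (l - int n)) \<subseteq> U})" by blast
  next
    fix x assume "x \<in> (\<Union>n. {x \<in> X. cball x (real CARD('p) powi (l - int n)) \<subseteq> U})"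
    then obtain n where "x \<in> X" "cball x (real CARD('p) powi (l - int n)) \<subseteq> U" by blast
    moreover have "x \<in> cball x (real CARD('p) powi (l - int n))"
      using prime_card_gt_1[where 'p = 'p] by simp
    ultimately show "x \<in> U \<inter> X" by blast
  qed
  have sets: "sets \<mu> = sets borel"
    using \<mu> by (simp add: normalized_Haar_measure_def)
  have "open (\<Union>(\<D> n))" for n
    unfolding \<D>_def nonexpanding_at_scale.balls_def[OF scale]
    by (intro open_Union) (auto intro: padic_open_cball simp: nonexpanding_at_scale.radius_pos[OF scale])
  moreover have "open (f -` V \<inter> X)" if "open V" for V
    using top_scale.continuous_on_domain open_domain that
    by (simp add: continuous_on_open_vimage)
  ultimately have meas: "\<Union>(\<D> n) \<in> sets \<mu>" "f -` (\<Union>(\<D> n)) \<inter> X \<in> sets \<mu>" for n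
    by (auto simp only: sets intro!: borel_open)
  \<comment> \<open>Values of \<open>f\<close> on \<open>X\<close> stay in \<open>X\<close>, so
    \<open>U\<close> may be replaced by \<open>U \<inter> X\<close>.\<close>
  have "emeasure \<mu> (f -` U \<inter> X) = emeasure \<mu> (f -` (U \<inter> X) \<inter> X)"
    using top_scale.maps_to by (intro arg_cong[where f = "emeasure \<mu>"]) blast
  also have "\<dots> = emeasure \<mu> (\<Union>n. f -` (\<Union>(\<D> n)) \<inter> X)"
    unfolding UX[symmetric] by (intro arg_cong[where f = "emeasure \<mu>"]) blast
  also have "\<dots> = (SUP n. emeasure \<mu> (f -` (\<Union>(\<D> n)) \<inter> X))"
  proof (rule SUP_emeasure_incseq[symmetric])
    show "incseq (\<lambda>n. f -` (\<Union>(\<D> n)) \<inter> X)"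
      using inc unfolding incseq_def by (intro allI impI Int_mono vimage_mono) auto
  qed (use meas in auto)
  also have "\<dots> = (SUP n. emeasure \<mu> (\<Union>(\<D> n)))"
  proof (rule SUP_cong[OF refl])
    fix n
    show "emeasure \<mu> (f -` (\<Union>(\<D> n)) \<inter> X) = emeasure \<mu> (\<Union>(\<D> n))"
      by (rule nonexpanding_at_scale.emeasure_vimage_Union_balls[OF scale \<mu> refl])
        (use assms(2) in \<open>auto simp: \<D>_def dense_image_def\<close>)
  qed
  also have "\<dots> = emeasure \<mu> (U \<inter> X)"
    unfolding UX[symmetric] using meas inc by (intro SUP_emeasure_incseq) auto
  finally show ?thesis .
qed

text \<open>The images of the restriction of \<open>\<mu>\<close> to \<open>X\<close> under
  \<open>f\<close> and under the identity agree on open sets, an intersection-stable generator of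
  the Borel sets, so they are equal.\<close>

lemma dense_image_measure_preserving:
  assumes \<mu>: "normalized_Haar_measure \<mu>" and dense_image
  shows "measure_preserving_on \<mu> X f"
proof -
  have sets: "sets \<mu> = sets borel"
    using \<mu> by (simp add: normalized_Haar_measure_def)
  then have space: "space \<mu> = UNIV"
    using sets_eq_imp_space_eq by fastforce
  have X: "X \<in> sets \<mu>" using open_domain by (simp add: sets)
  have cont: "g \<in> borel_measurable (restrict_space \<mu> X)" if "continuous_on X g" for g :: "'p padic \<Rightarrow> 'p padic"
    using borel_measurable_continuous_on_restrict[OF that]
      measurable_cong_sets[OF sets_restrict_space_cong[OF sets] refl] by blast
  have vimage: "g -` A \<inter> X \<in> sets \<mu>
      \<and> emeasure (distr (restrict_space \<mu> X) borel g) A = emeasure \<mu> (g -` A \<inter> X)"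
    if g: "continuous_on X g" and A: "A \<in> sets borel" for g :: "'p padic \<Rightarrow> 'p padic" and A
  proof
    have "g -` A \<inter> X \<in> sets (restrict_space \<mu> X)"
      using measurable_sets[OF cont[OF g] A] by (simp add: space_restrict_space space)
    then show "g -` A \<inter> X \<in> sets \<mu>"
      using X by (simp add: sets_restrict_space_iff space)
    show "emeasure (distr (restrict_space \<mu> X) borel g) A = emeasure \<mu> (g -` A \<inter> X)"
      using A X cont[OF g]
      by (simp add: emeasure_distr emeasure_restrict_space space_restrict_space space)
  qed
  note cont_f = top_scale.continuous_on_domain
  have "distr (restrict_space \<mu> X) borel f = distr (restrict_space \<mu> X) borel (\<lambda>x. x)"
  \<comment> \<open>Since the total mass is finite, the constant sequence \<open>UNIV\<close> serves
    as the exhaustion.\<close>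
  proof (rule measure_eqI_generator_eq[where E = "{S. open S}" and \<Omega> = UNIV and A = "\<lambda>_. UNIV"])
    show "Int_stable {S :: 'p padic set. open S}"
      by (auto simp: Int_stable_def)
    show "emeasure (distr (restrict_space \<mu> X) borel f) U
        = emeasure (distr (restrict_space \<mu> X) borel (\<lambda>x. x)) U" if "U \<in> {S. open S}" for U
      using that vimage[OF cont_f, of U] vimage[OF continuous_on_id, of U]
        emeasure_vimage_open[OF assms, of U]
      by (simp add: vimage_def)
    show "emeasure (distr (restrict_space \<mu> X) borel f) UNIV \<noteq> \<infinity>"
      using vimage[OF cont_f, of UNIV] emeasure_domain_finite[OF \<mu>] by simp
  qed (auto simp: borel_def)
  then have "emeasure \<mu> (f -` A \<inter> X) = emeasure \<mu> (A \<inter> X)" if "A \<in> sets borel" for A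
    using vimage[OF cont_f that] vimage[OF continuous_on_id that] by (simp add: vimage_def)
  then show ?thesis
    unfolding measure_preserving_on_def using vimage[OF cont_f] sets by (auto simp: Int_absorb2)
qed

lemma disjoint_union_of_cycles_iff_dense_image:
  "(\<forall>t\<le>l. disjoint_union_of_cycles (ball_digraph X f (real CARD('p) powi t))) \<longleftrightarrow> dense_image"
  unfolding dense_image_def
  by (simp add: nonexpanding_at_scale.disjoint_union_of_cycles_iff nonexpanding_at cong: imp_cong)

end

theorem theorem3p1:
  fixes X :: "'p::prime_card padic set"
    and f :: "'p padic \<Rightarrow> 'p padic"
    and \<mu> :: "'p padic measure"
    and l :: int
  assumes "normalized_Haar_measure \<mu>"
    and "compact X" and "open X"
    and "rational_function_on X f"
    and "locally_1_Lipschitz_on X f"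
    and "\<And>a. a \<in> X \<Longrightarrow> cball a (real CARD('p) powi l) \<subseteq> X"
    and "\<And>a x y. \<lbrakk>a \<in> X; x \<in> cball a (real CARD('p) powi l); y \<in> cball a (real CARD('p) powi l)\<rbrakk>
           \<Longrightarrow> padic_abs (f x - f y) \<le> padic_abs (x - y)"
  shows "(measure_preserving_on \<mu> X f \<longleftrightarrow> invertible_on X f)
    \<and> (invertible_on X f \<longleftrightarrow> invertible_on X f \<and> locally_isometric_on X f)
    \<and> (invertible_on X f \<and> locally_isometric_on X f \<longleftrightarrow>
        (\<forall>t\<le>l. disjoint_union_of_cycles (ball_digraph X f (real CARD('p) powi t))))"
proof -
  have P: "real CARD('p) > 1" by (rule prime_card_gt_1)
  interpret nonexpanding_below_scale X f l
  proof (rule nonexpanding_below_scale.intro)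
    fix t assume "t \<le> l"
    then have le: "real CARD('p) powi t \<le> real CARD('p) powi l"
      using P by (intro power_int_increasing) auto
    show "nonexpanding_at_scale X f (real CARD('p) powi t)"
    proof
      show "f ` X \<subseteq> X"
        using assms(4) by (simp add: rational_function_on_def)
      show "cball a (real CARD('p) powi t) \<subseteq> X" if "a \<in> X" for a
        using assms(6)[OF that] subset_cball[OF le] by blast
      \<comment> \<open>The hypothesis on balls is applied to the ball of radius \<open>p^l\<close>
        centred at \<open>x\<close> itself.\<close>
      show "dist (f x) (f y) \<le> dist x y"
        if "x \<in> X" "y \<in> X" "dist x y \<le> real CARD('p) powi t" for x y
        using assms(7)[of x x y] that le P by (simp add: dist_padic_def)
    qed (use P assms(2) in auto)
  qed
  have "measure_preserving_on \<mu> X f \<longleftrightarrow> dense_image"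
    using measure_preserving_dense_image dense_image_measure_preserving assms(1) by blast
  moreover have "invertible_on X f \<longleftrightarrow> dense_image"
    using invertible_dense_image dense_image_invertible by blast
  \<comment> \<open>For the third condition: invertibility gives density, and density gives local
    isometry.\<close>
  ultimately show ?thesis
    using disjoint_union_of_cycles_iff_dense_image dense_image_locally_isometric by blast
qed

end
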